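(* Let $\mathcal{S}=\langle\mathcal{X},\mathcal{Y},\alpha,\varphi\rangle$ be a constrained $\mathsf{LTL_f}$ specification and let $\mathsf{alive},\mathsf{end}$ be fresh variables. Then $\mathcal{S}$ is realizable iff the $\mathsf{LTL}$ specification $\mathcal{S}^\infty=\langle\mathcal{X},\mathcal{Y}\cup\{\mathsf{alive},\mathsf{end}\},\psi_{\alpha,\varphi}\rangle$ is realizable. Moreover, for every winning strategy $\sigma$ for $\mathcal{S}^\infty$, the function $\sigma'$ defined by $\sigma'(X_1\cdots X_n):=\sigma(X_1\cdots X_n)\setminus\{\mathsf{alive}\}$ is a winning strategy for $\mathcal{S}$.
   Context: Formulas over variables $\mathcal{P}$ are built from $\top,\bot,p,\neg,\wedge,\vee,\mathsf{X},\mathsf{U},\mathsf{R}$; $\mathsf{F}\psi:=\top\mathsf{U}\psi$, $\mathsf{G}\psi:=\bot\mathsf{R}\psi$, $\to,\leftrightarrow$ as usual. $\mathsf{LTL}$ is interpreted on infinite traces (infinite words over $2^{\mathcal{P}}$) in the usual way; $\mathsf{LTL_f}$ on finite traces $\pi$: $\pi\models_i\mathsf{X}\psi$ iff $|\pi|>i$ and $\pi\models_{i+1}\psi$, and $\mathsf{U},\mathsf{R}$ range only over positions $j\le|\pi|$. Translation: for an $\mathsf{LTL_f}$ formula written with $\top,\bot,p,\neg,\wedge,\mathsf{X},\mathsf{U}$ (other connectives eliminated by $\psi_1\vee\psi_2\equiv\neg(\neg\psi_1\wedge\neg\psi_2)$, $\psi_1\mathsf{R}\psi_2\equiv\neg(\neg\psi_1\mathsf{U}\neg\psi_2)$),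 define $\tau(p)=p$, $\tau(\top)=\top$, $\tau(\bot)=\bot$, $\tau(\neg\psi)=\neg\tau(\psi)$, $\tau(\psi_1\wedge\psi_2)=\tau(\psi_1)\wedge\tau(\psi_2)$, $\tau(\mathsf{X}\psi)=\mathsf{X}(\mathsf{alive}\wedge\tau(\psi))$, $\tau(\psi_1\mathsf{U}\psi_2)=\tau(\psi_1)\mathsf{U}(\mathsf{alive}\wedge\tau(\psi_2))$. Let $\varphi_{\mathsf{inf}}:=\tau(\varphi)\wedge\mathsf{alive}\wedge(\mathsf{alive}\,\mathsf{U}\,\mathsf{G}\neg\mathsf{alive})$, $\psi_{\mathsf{end}}:=\mathsf{G}(\mathsf{end}\leftrightarrow\mathsf{alive}\wedge\mathsf{X}\neg\mathsf{alive})\wedge\mathsf{G}(\mathsf{end}\rightarrow\mathsf{X}\mathsf{G}\neg\mathsf{end})$, and $\psi_{\alpha,\varphi}:=\psi_{\mathsf{end}}\wedge((\alpha\vee\mathsf{F}\,\mathsf{end})\rightarrow\varphi_{\mathsf{inf}})$. $\mathsf{LTL}$ specification $\langle\mathcal{X},\mathcal{Y}',\psi\rangle$: a strategy is any $\sigma:(2^{\mathcal{X}})^*\to2^{\mathcal{Y}'}$; it is winning if for every infinite $\mathbf{X}=X_1X_2\dots$ of subsets of $\mathcal{X}$, the infinite trace $(X_1\cup\sigma(X_1))(X_2\cup\sigma(X_1X_2))\cdots$ satisfies $\psi$ (here $\mathsf{end}$ is an ordinary variable). Realizable iff a winning strategy exists. Constrained $\mathsf{LTL_f}$ specification $\langle\mathcal{X},\mathcal{Y},\alpha,\varphi\rangle$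 ($\mathcal{X},\mathcal{Y}$ disjoint; $\alpha$ an $\mathsf{LTL}$ formula, $\varphi$ an $\mathsf{LTL_f}$ formula, both over $\mathcal{X}\cup\mathcal{Y}$): a strategy is $\sigma:(2^{\mathcal{X}})^*\to2^{\mathcal{Y}\cup\{\mathsf{end}\}}$ such that for every $\mathbf{X}$ there is at most one $n=n_{\sigma,\mathbf{X}}$ with $\mathsf{end}\in\sigma(X_1\cdots X_n)$ ($\infty$ if none); induced infinite trace $(X_1\cup\sigma(X_1))(X_2\cup\sigma(X_1X_2))\cdots$; if $n<\infty$ induced finite trace $(X_1\cup\sigma(X_1))\cdots(X_n\cup\sigma(X_1\cdots X_n))$ with $\mathsf{end}$ removed. Winning iff for every $\mathbf{X}$: either $n_{\sigma,\mathbf{X}}=\infty$ and the induced infinite trace falsifies $\alpha$, or $n_{\sigma,\mathbf{X}}<\infty$ and the induced finite trace satisfies $\varphi$. *)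

theory Defs
  imports
    "HOL-Library.Omega_Words_Fun"
    "HOL-Library.Extended_Nat"
    "HOL-Library.FuncSet"
begin

section \<open>Formulas\<close>

datatype (vars: 'v) formula =
    Top
  | Bot
  | Var 'v
  | Neg "'v formula"
  | And "'v formula" "'v formula"
  | Or "'v formula" "'v formula"
  | Next "'v formula"
  | Until "'v formula" "'v formula"
  | Release "'v formula" "'v formula"

definition Finally :: "'v formula \<Rightarrow> 'v formula" where
  "Finally \<psi> = Until Top \<psi>"

definition Globally :: "'v formula \<Rightarrow> 'v formula" where
  "Globally \<psi> = Release Bot \<psi>"

definition Imp :: "'v formula \<Rightarrow> 'v formula \<Rightarrow> 'v formula" where
  "Imp \<psi>\<^sub>1 \<psi>\<^sub>2 = Or (Neg \<psi>\<^sub>1) \<psi>\<^sub>2"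

definition Iff :: "'v formula \<Rightarrow> 'v formula \<Rightarrow> 'v formula" where
  "Iff \<psi>\<^sub>1 \<psi>\<^sub>2 = And (Imp \<psi>\<^sub>1 \<psi>\<^sub>2) (Imp \<psi>\<^sub>2 \<psi>\<^sub>1)"


section \<open>Semantics\<close>

text \<open>
  Positions are counted from 0: position \<open>i\<close> here is the position that is called \<open>i + 1\<close>
  when the first letter of a trace has index 1. An infinite trace is an \<open>\<omega>\<close>-word over sets of
  variables, a finite trace is a list of such sets.
\<close>

primrec ltl_sat :: "'v set word \<Rightarrow> nat \<Rightarrow> 'v formula \<Rightarrow> bool" where
  "ltl_sat \<pi> i Top \<longleftrightarrow> True"
| "ltl_sat \<pi> i Bot \<longleftrightarrow> False"
| "ltl_sat \<pi> i (Var p) \<longleftrightarrow> p \<in> \<pi> i"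
| "ltl_sat \<pi> i (Neg \<psi>) \<longleftrightarrow> \<not> ltl_sat \<pi> i \<psi>"
| "ltl_sat \<pi> i (And \<psi>\<^sub>1 \<psi>\<^sub>2) \<longleftrightarrow> ltl_sat \<pi> i \<psi>\<^sub>1 \<and> ltl_sat \<pi> i \<psi>\<^sub>2"
| "ltl_sat \<pi> i (Or \<psi>\<^sub>1 \<psi>\<^sub>2) \<longleftrightarrow> ltl_sat \<pi> i \<psi>\<^sub>1 \<or> ltl_sat \<pi> i \<psi>\<^sub>2"
| "ltl_sat \<pi> i (Next \<psi>) \<longleftrightarrow> ltl_sat \<pi> (Suc i) \<psi>"
| "ltl_sat \<pi> i (Until \<psi>\<^sub>1 \<psi>\<^sub>2) \<longleftrightarrow>
     (\<exists>j\<ge>i. ltl_sat \<pi> j \<psi>\<^sub>2 \<and> (\<forall>k\<in>{i..<j}. ltl_sat \<pi> k \<psi>\<^sub>1))"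
| "ltl_sat \<pi> i (Release \<psi>\<^sub>1 \<psi>\<^sub>2) \<longleftrightarrow>
     (\<forall>j\<ge>i. ltl_sat \<pi> j \<psi>\<^sub>2 \<or> (\<exists>k\<in>{i..<j}. ltl_sat \<pi> k \<psi>\<^sub>1))"

primrec ltlf_sat :: "'v set list \<Rightarrow> nat \<Rightarrow> 'v formula \<Rightarrow> bool" where
  "ltlf_sat \<pi> i Top \<longleftrightarrow> True"
| "ltlf_sat \<pi> i Bot \<longleftrightarrow> False"
| "ltlf_sat \<pi> i (Var p) \<longleftrightarrow> p \<in> \<pi> ! i"
| "ltlf_sat \<pi> i (Neg \<psi>) \<longleftrightarrow> \<not> ltlf_sat \<pi> i \<psi>"
| "ltlf_sat \<pi> i (And \<psi>\<^sub>1 \<psi>\<^sub>2) \<longleftrightarrow> ltlf_sat \<pi> i \<psi>\<^sub>1 \<and> ltlf_sat \<pi> i \<psi>\<^sub>2"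
| "ltlf_sat \<pi> i (Or \<psi>\<^sub>1 \<psi>\<^sub>2) \<longleftrightarrow> ltlf_sat \<pi> i \<psi>\<^sub>1 \<or> ltlf_sat \<pi> i \<psi>\<^sub>2"
| "ltlf_sat \<pi> i (Next \<psi>) \<longleftrightarrow> Suc i < length \<pi> \<and> ltlf_sat \<pi> (Suc i) \<psi>"
| "ltlf_sat \<pi> i (Until \<psi>\<^sub>1 \<psi>\<^sub>2) \<longleftrightarrow>
     (\<exists>j\<in>{i..<length \<pi>}. ltlf_sat \<pi> j \<psi>\<^sub>2 \<and> (\<forall>k\<in>{i..<j}. ltlf_sat \<pi> k \<psi>\<^sub>1))"
| "ltlf_sat \<pi> i (Release \<psi>\<^sub>1 \<psi>\<^sub>2) \<longleftrightarrow>
     (\<forall>j\<in>{i..<length \<pi>}. ltlf_sat \<pi> j \<psi>\<^sub>2 \<or> (\<exists>k\<in>{i..<j}. ltlf_sat \<pi> k \<psi>\<^sub>1))"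

definition ltl_models :: "'v set word \<Rightarrow> 'v formula \<Rightarrow> bool"  (infix \<open>\<Turnstile>\<^sub>\<infinity>\<close> 55) where
  "\<pi> \<Turnstile>\<^sub>\<infinity> \<psi> \<longleftrightarrow> ltl_sat \<pi> 0 \<psi>"

definition ltlf_models :: "'v set list \<Rightarrow> 'v formula \<Rightarrow> bool"  (infix \<open>\<Turnstile>\<^sub>f\<close> 55) where
  "\<pi> \<Turnstile>\<^sub>f \<psi> \<longleftrightarrow> ltlf_sat \<pi> 0 \<psi>"


section \<open>Translation to infinite traces\<close>

text \<open>
  The equations for \<^const>\<open>Or\<close> and \<^const>\<open>Release\<close> are what one gets by first eliminating these
  connectives; see the two lemmas below. The variable \<open>end\<close> is written \<open>fin\<close>, since \<open>end\<close> is a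
  keyword.
\<close>

primrec ltlf_to_ltl :: "'v \<Rightarrow> 'v formula \<Rightarrow> 'v formula" where
  "ltlf_to_ltl alive Top = Top"
| "ltlf_to_ltl alive Bot = Bot"
| "ltlf_to_ltl alive (Var p) = Var p"
| "ltlf_to_ltl alive (Neg \<psi>) = Neg (ltlf_to_ltl alive \<psi>)"
| "ltlf_to_ltl alive (And \<psi>\<^sub>1 \<psi>\<^sub>2) = And (ltlf_to_ltl alive \<psi>\<^sub>1) (ltlf_to_ltl alive \<psi>\<^sub>2)"
| "ltlf_to_ltl alive (Or \<psi>\<^sub>1 \<psi>\<^sub>2) =
     Neg (And (Neg (ltlf_to_ltl alive \<psi>\<^sub>1)) (Neg (ltlf_to_ltl alive \<psi>\<^sub>2)))"
| "ltlf_to_ltl alive (Next \<psi>) = Next (And (Var alive) (ltlf_to_ltl alive \<psi>))"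
| "ltlf_to_ltl alive (Until \<psi>\<^sub>1 \<psi>\<^sub>2) =
     Until (ltlf_to_ltl alive \<psi>\<^sub>1) (And (Var alive) (ltlf_to_ltl alive \<psi>\<^sub>2))"
| "ltlf_to_ltl alive (Release \<psi>\<^sub>1 \<psi>\<^sub>2) =
     Neg (Until (Neg (ltlf_to_ltl alive \<psi>\<^sub>1)) (And (Var alive) (Neg (ltlf_to_ltl alive \<psi>\<^sub>2))))"

lemma ltlf_to_ltl_Or_elim:
  "ltlf_to_ltl alive (Or \<psi>\<^sub>1 \<psi>\<^sub>2) = ltlf_to_ltl alive (Neg (And (Neg \<psi>\<^sub>1) (Neg \<psi>\<^sub>2)))"
  by simp

lemma ltlf_to_ltl_Release_elim:
  "ltlf_to_ltl alive (Release \<psi>\<^sub>1 \<psi>\<^sub>2) = ltlf_to_ltl alive (Neg (Until (Neg \<psi>\<^sub>1) (Neg \<psi>\<^sub>2)))"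
  by simp

definition phi_inf :: "'v \<Rightarrow> 'v formula \<Rightarrow> 'v formula" where
  "phi_inf alive \<phi> =
     And (ltlf_to_ltl alive \<phi>)
       (And (Var alive) (Until (Var alive) (Globally (Neg (Var alive)))))"

definition psi_end :: "'v \<Rightarrow> 'v \<Rightarrow> 'v formula" where
  "psi_end alive fin =
     And (Globally (Iff (Var fin) (And (Var alive) (Next (Neg (Var alive))))))
       (Globally (Imp (Var fin) (Next (Globally (Neg (Var fin))))))"

definition psi_constrained :: "'v \<Rightarrow> 'v \<Rightarrow> 'v formula \<Rightarrow> 'v formula \<Rightarrow> 'v formula" where
  "psi_constrained alive fin \<alpha> \<phi> =
     And (psi_end alive fin) (Imp (Or \<alpha> (Finally (Var fin))) (phi_inf alive \<phi>))"


section \<open>Strategies and realizability\<close>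

text \<open>
  The input sequence \<open>X\<^sub>1 X\<^sub>2 \<dots>\<close> is the \<open>\<omega>\<close>-word \<open>Xs\<close> with \<open>Xs i = X\<^sub>i\<^sub>+\<^sub>1\<close>, so
  \<open>X\<^sub>1 \<dots> X\<^sub>n\<close> is \<open>prefix n Xs\<close>.
\<close>

type_synonym 'v strategy = "'v set list \<Rightarrow> 'v set"

definition strategies :: "'v set \<Rightarrow> 'v set \<Rightarrow> 'v strategy set" where
  "strategies X Y = lists (Pow X) \<rightarrow> Pow Y"

definition inputs :: "'v set \<Rightarrow> 'v set word set" where
  "inputs X = UNIV \<rightarrow> Pow X"

definition inf_trace :: "'v strategy \<Rightarrow> 'v set word \<Rightarrow> 'v set word" where
  "inf_trace \<sigma> Xs = (\<lambda>i. Xs i \<union> \<sigma> (prefix (Suc i) Xs))"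

definition ltl_winning :: "'v set \<Rightarrow> 'v set \<Rightarrow> 'v formula \<Rightarrow> 'v strategy \<Rightarrow> bool" where
  "ltl_winning X Y \<chi> \<sigma> \<longleftrightarrow>
     \<sigma> \<in> strategies X Y \<and> (\<forall>Xs\<in>inputs X. inf_trace \<sigma> Xs \<Turnstile>\<^sub>\<infinity> \<chi>)"

definition ltl_realizable :: "'v set \<Rightarrow> 'v set \<Rightarrow> 'v formula \<Rightarrow> bool" where
  "ltl_realizable X Y \<chi> \<longleftrightarrow> (\<exists>\<sigma>. ltl_winning X Y \<chi> \<sigma>)"

definition constrained_spec ::
  "'v set \<Rightarrow> 'v set \<Rightarrow> 'v formula \<Rightarrow> 'v formula \<Rightarrow> bool" where
  "constrained_spec X Y \<alpha> \<phi> \<longleftrightarrow>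
     X \<inter> Y = {} \<and> vars \<alpha> \<subseteq> X \<union> Y \<and> vars \<phi> \<subseteq> X \<union> Y"

text \<open>
  Traces start with \<open>X\<^sub>1\<close>, so only the steps \<open>n \<ge> 1\<close> count: the value of a strategy on the empty
  word does not occur in any trace and is irrelevant.
\<close>

definition ends_at :: "'v \<Rightarrow> 'v strategy \<Rightarrow> 'v set word \<Rightarrow> nat \<Rightarrow> bool" where
  "ends_at fin \<sigma> Xs n \<longleftrightarrow> n \<ge> 1 \<and> fin \<in> \<sigma> (prefix n Xs)"

definition constrained_strategies :: "'v \<Rightarrow> 'v set \<Rightarrow> 'v set \<Rightarrow> 'v strategy set" where
  "constrained_strategies fin X Y =
     {\<sigma> \<in> strategies X (Y \<union> {fin}). \<forall>Xs\<in>inputs X. \<exists>\<^sub>\<le>\<^sub>1 n. ends_at fin \<sigma> Xs n}"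

definition end_step :: "'v \<Rightarrow> 'v strategy \<Rightarrow> 'v set word \<Rightarrow> enat" where
  "end_step fin \<sigma> Xs =
     (if \<exists>n. ends_at fin \<sigma> Xs n then enat (THE n. ends_at fin \<sigma> Xs n) else \<infinity>)"

definition fin_trace :: "'v \<Rightarrow> 'v strategy \<Rightarrow> 'v set word \<Rightarrow> nat \<Rightarrow> 'v set list" where
  "fin_trace fin \<sigma> Xs n = map (\<lambda>A. A - {fin}) (prefix n (inf_trace \<sigma> Xs))"

definition constrained_winning ::
  "'v \<Rightarrow> 'v set \<Rightarrow> 'v set \<Rightarrow> 'v formula \<Rightarrow> 'v formula \<Rightarrow> 'v strategy \<Rightarrow> bool" where
  "constrained_winning fin X Y \<alpha> \<phi> \<sigma> \<longleftrightarrow>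
     \<sigma> \<in> constrained_strategies fin X Y \<and>
     (\<forall>Xs\<in>inputs X.
        (end_step fin \<sigma> Xs = \<infinity> \<and> \<not> inf_trace \<sigma> Xs \<Turnstile>\<^sub>\<infinity> \<alpha>) \<or>
        (\<exists>n. end_step fin \<sigma> Xs = enat n \<and> fin_trace fin \<sigma> Xs n \<Turnstile>\<^sub>f \<phi>))"

definition constrained_realizable ::
  "'v \<Rightarrow> 'v set \<Rightarrow> 'v set \<Rightarrow> 'v formula \<Rightarrow> 'v formula \<Rightarrow> bool" where
  "constrained_realizable fin X Y \<alpha> \<phi> \<longleftrightarrow> (\<exists>\<sigma>. constrained_winning fin X Y \<alpha> \<phi> \<sigma>)"

end

theory Submission
  imports Defs
begin

text \<open>
  A trace satisfying \<open>\<phi>\<^sub>i\<^sub>n\<^sub>f\<close> is alive on exactly a nonempty initial segment, and \<open>\<psi>\<^sub>e\<^sub>n\<^sub>d\<close> makes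
  \<open>end\<close> mark the last position of that segment; on such a trace \<open>\<tau>(\<phi>)\<close> evaluates \<open>\<phi>\<close> on the
  segment. Dropping \<open>alive\<close> from a winning strategy for \<open>\<S>\<^sup>\<infinity>\<close> therefore wins \<open>\<S>\<close>: if \<open>end\<close> never
  occurs, then \<open>\<alpha>\<close> fails, since \<open>\<alpha>\<close> would force \<open>\<phi>\<^sub>i\<^sub>n\<^sub>f\<close> and thereby \<open>end\<close>. Conversely, a winning
  strategy for \<open>\<S>\<close> is extended by playing \<open>alive\<close> up to and including the step at which it plays
  \<open>end\<close>.
\<close>

lemma ltl_sat_Globally [simp]: "ltl_sat \<pi> i (Globally \<psi>) \<longleftrightarrow> (\<forall>j\<ge>i. ltl_sat \<pi> j \<psi>)"
  by (simp add: Globally_def)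

lemma ltl_sat_Finally [simp]: "ltl_sat \<pi> i (Finally \<psi>) \<longleftrightarrow> (\<exists>j\<ge>i. ltl_sat \<pi> j \<psi>)"
  by (simp add: Finally_def)

lemma ltl_sat_Imp [simp]: "ltl_sat \<pi> i (Imp \<psi> \<chi>) \<longleftrightarrow> (ltl_sat \<pi> i \<psi> \<longrightarrow> ltl_sat \<pi> i \<chi>)"
  by (auto simp: Imp_def)

lemma ltl_sat_Iff [simp]: "ltl_sat \<pi> i (Iff \<psi> \<chi>) \<longleftrightarrow> (ltl_sat \<pi> i \<psi> \<longleftrightarrow> ltl_sat \<pi> i \<chi>)"
  by (auto simp: Iff_def)

lemma ltl_sat_vars_cong:
  assumes "\<And>i p. p \<in> vars \<psi> \<Longrightarrow> p \<in> \<pi> i \<longleftrightarrow> p \<in> \<pi>' i"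
  shows "ltl_sat \<pi> i \<psi> \<longleftrightarrow> ltl_sat \<pi>' i \<psi>"
  using assms by (induction \<psi> arbitrary: i) auto

text \<open>The guard \<open>alive\<close> confines the target of \<open>Next\<close> and the
  witness of \<open>Until\<close> to positions below \<open>length \<rho>\<close>; the left operand
  of \<open>Until\<close> is evaluated only before such a witness, hence inside the segment too.
  Agreement is asked only on \<open>vars \<psi>\<close>, so \<open>\<pi>\<close> may carry
  \<open>alive\<close> and \<open>end\<close> while \<open>\<rho>\<close> does not.\<close>

lemma ltl_sat_ltlf_to_ltl:
  assumes "\<And>i. alive \<in> \<pi> i \<longleftrightarrow> i < length \<rho>"
    and "\<And>i p. i < length \<rho> \<Longrightarrow> p \<in> vars \<psi> \<Longrightarrow> p \<in> \<pi> i \<longleftrightarrow> p \<in> \<rho> ! i"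
    and "i < length \<rho>"
  shows "ltl_sat \<pi> i (ltlf_to_ltl alive \<psi>) \<longleftrightarrow> ltlf_sat \<rho> i \<psi>"
  using assms(2,3)
proof (induction \<psi> arbitrary: i)
  case (Next \<psi>)
  then show ?case by (auto simp: assms(1))
next
  case (Until \<psi>\<^sub>1 \<psi>\<^sub>2)
  then have "ltl_sat \<pi> j (ltlf_to_ltl alive \<psi>\<^sub>1) \<longleftrightarrow> ltlf_sat \<rho> j \<psi>\<^sub>1"
    "ltl_sat \<pi> j (ltlf_to_ltl alive \<psi>\<^sub>2) \<longleftrightarrow> ltlf_sat \<rho> j \<psi>\<^sub>2" if "j < length \<rho>" for j
    using that by simp_all
  \<comment> \<open>Every position before a witness \<open>j < length \<rho>\<close> is itself below
    \<open>length \<rho>\<close>, so the equivalences above apply to it.\<close>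
  then show ?case
    by (simp add: assms(1) Bex_def Ball_def) (meson less_trans)
next
  case (Release \<psi>\<^sub>1 \<psi>\<^sub>2)
  then have "ltl_sat \<pi> j (ltlf_to_ltl alive \<psi>\<^sub>1) \<longleftrightarrow> ltlf_sat \<rho> j \<psi>\<^sub>1"
    "ltl_sat \<pi> j (ltlf_to_ltl alive \<psi>\<^sub>2) \<longleftrightarrow> ltlf_sat \<rho> j \<psi>\<^sub>2" if "j < length \<rho>" for j
    using that by simp_all
  then show ?case
    by (simp add: assms(1) Bex_def Ball_def) (meson less_trans)
qed auto

lemma ltl_models_psi_end:
  "\<pi> \<Turnstile>\<^sub>\<infinity> psi_end alive fin \<longleftrightarrow>
     (\<forall>i. fin \<in> \<pi> i \<longleftrightarrow> alive \<in> \<pi> i \<and> alive \<notin> \<pi> (Suc i)) \<and>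
     (\<forall>i j. fin \<in> \<pi> i \<longrightarrow> i < j \<longrightarrow> fin \<notin> \<pi> j)"
  by (auto simp: ltl_models_def psi_end_def Suc_le_eq)

text \<open>The witness of the outer \<open>Until\<close> is the length of the alive segment;
  \<open>alive\<close> at position 0 rules out length 0.\<close>

lemma ltl_models_phi_inf:
  "\<pi> \<Turnstile>\<^sub>\<infinity> phi_inf alive \<phi> \<longleftrightarrow>
     \<pi> \<Turnstile>\<^sub>\<infinity> ltlf_to_ltl alive \<phi> \<and> (\<exists>n\<ge>1. \<forall>i. alive \<in> \<pi> i \<longleftrightarrow> i < n)"
proof -
  have "alive \<in> \<pi> 0 \<and> (\<exists>n. (\<forall>j\<ge>n. alive \<notin> \<pi> j) \<and> (\<forall>k\<in>{0..<n}. alive \<in> \<pi> k)) \<longleftrightarrow>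
    (\<exists>n\<ge>1. \<forall>i. alive \<in> \<pi> i \<longleftrightarrow> i < n)" (is "?L \<longleftrightarrow> ?R")
  proof
    assume ?L
    then obtain n where "alive \<in> \<pi> 0" "\<And>j. j \<ge> n \<Longrightarrow> alive \<notin> \<pi> j" "\<And>k. k < n \<Longrightarrow> alive \<in> \<pi> k"
      by (metis atLeastLessThan_iff le0)
    then have "n \<ge> 1 \<and> (\<forall>i. alive \<in> \<pi> i \<longleftrightarrow> i < n)"
      by (metis not_le less_one le0)
    then show ?R by blast
  next
    assume ?R
    then show ?L by (force simp: not_less)
  qed
  then show ?thesis
    by (simp add: ltl_models_def phi_inf_def)
qed

lemma ltl_models_psi_constrained:
  "\<pi> \<Turnstile>\<^sub>\<infinity> psi_constrained alive fin \<alpha> \<phi> \<longleftrightarrow>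
     \<pi> \<Turnstile>\<^sub>\<infinity> psi_end alive fin \<and>
     (\<pi> \<Turnstile>\<^sub>\<infinity> \<alpha> \<or> (\<exists>i. fin \<in> \<pi> i) \<longrightarrow> \<pi> \<Turnstile>\<^sub>\<infinity> phi_inf alive \<phi>)"
  by (auto simp: ltl_models_def psi_constrained_def)

lemma end_step_eq_infinity_iff: "end_step fin \<sigma> Xs = \<infinity> \<longleftrightarrow> (\<forall>n. \<not> ends_at fin \<sigma> Xs n)"
  by (simp add: end_step_def)

lemma end_step_eq_enat_iff:
  assumes "\<exists>\<^sub>\<le>\<^sub>1 n. ends_at fin \<sigma> Xs n"
  shows "end_step fin \<sigma> Xs = enat n \<longleftrightarrow> ends_at fin \<sigma> Xs n"
  using the1_equality'[OF assms] by (auto simp: end_step_def)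

text \<open>Eliminates the description operator in \<open>end_step\<close>: with uniqueness stated
  next to the winning condition for the same input, \<open>end_step\<close> can be replaced by
  \<open>ends_at\<close>.\<close>

lemma constrained_winning_iff:
  "constrained_winning fin X Y \<alpha> \<phi> \<sigma> \<longleftrightarrow>
     \<sigma> \<in> strategies X (Y \<union> {fin}) \<and>
     (\<forall>Xs\<in>inputs X. (\<exists>\<^sub>\<le>\<^sub>1 n. ends_at fin \<sigma> Xs n) \<and>
        ((\<forall>n. \<not> ends_at fin \<sigma> Xs n) \<and> \<not> inf_trace \<sigma> Xs \<Turnstile>\<^sub>\<infinity> \<alpha> \<or>
         (\<exists>n. ends_at fin \<sigma> Xs n \<and> fin_trace fin \<sigma> Xs n \<Turnstile>\<^sub>f \<phi>)))"
  unfolding constrained_winning_def constrained_strategies_def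
  using end_step_eq_infinity_iff end_step_eq_enat_iff by (smt (verit) mem_Collect_eq)

text \<open>Steps count from 1 and trace positions from 0, hence the shift. Since
  \<open>fin \<notin> X\<close>, an occurrence of \<open>fin\<close> in the trace comes from the
  strategy.\<close>

lemma ends_at_Suc_iff:
  assumes "Xs \<in> inputs X" "fin \<notin> X"
  shows "ends_at fin \<sigma> Xs (Suc i) \<longleftrightarrow> fin \<in> inf_trace \<sigma> Xs i"
  using assms by (auto simp: ends_at_def inf_trace_def inputs_def)

lemma ends_atE:
  assumes "ends_at fin \<sigma> Xs n"
  obtains i where "n = Suc i" "ends_at fin \<sigma> Xs (Suc i)"
  using assms by (cases n) (auto simp: ends_at_def)

text \<open>Equality up to \<open>alive\<close> is the relation between the two strategies in both
  directions of the equivalence, whether \<open>alive\<close> is dropped or added.\<close>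

lemma inf_trace_agree:
  assumes "\<And>w. \<sigma> w - {alive} = \<sigma>' w - {alive}" "p \<noteq> alive"
  shows "p \<in> inf_trace \<sigma> Xs i \<longleftrightarrow> p \<in> inf_trace \<sigma>' Xs i"
  using assms unfolding inf_trace_def by blast

lemma ends_at_agree:
  assumes "\<And>w. \<sigma> w - {alive} = \<sigma>' w - {alive}" "fin \<noteq> alive"
  shows "ends_at fin \<sigma> Xs n \<longleftrightarrow> ends_at fin \<sigma>' Xs n"
  using assms unfolding ends_at_def by blast

lemma ltl_models_agree:
  assumes "\<And>w. \<sigma> w - {alive} = \<sigma>' w - {alive}" "alive \<notin> vars \<alpha>"
  shows "inf_trace \<sigma> Xs \<Turnstile>\<^sub>\<infinity> \<alpha> \<longleftrightarrow> inf_trace \<sigma>' Xs \<Turnstile>\<^sub>\<infinity> \<alpha>"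
  unfolding ltl_models_def
  by (rule ltl_sat_vars_cong, rule inf_trace_agree[OF assms(1)]) (use assms(2) in auto)

text \<open>Compares the infinite trace of the strategy playing \<open>alive\<close> with the finite
  trace of its counterpart. They can differ on the first \<open>n\<close> positions only in
  \<open>alive\<close> and \<open>fin\<close>, neither of which occurs in \<open>\<phi>\<close>;
  \<open>n \<ge> 1\<close> places position 0 inside the finite trace.\<close>

lemma ltlf_to_ltl_models_agree:
  assumes agree: "\<And>w. \<sigma> w - {alive} = \<sigma>' w - {alive}"
    and "alive \<notin> vars \<phi>" "fin \<notin> vars \<phi>"
    and alive: "\<And>i. alive \<in> inf_trace \<sigma> Xs i \<longleftrightarrow> i < n" and "n \<ge> 1"
  shows "inf_trace \<sigma> Xs \<Turnstile>\<^sub>\<infinity> ltlf_to_ltl alive \<phi> \<longleftrightarrow> fin_trace fin \<sigma>' Xs n \<Turnstile>\<^sub>f \<phi>"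
  unfolding ltl_models_def ltlf_models_def
proof (rule ltl_sat_ltlf_to_ltl)
  fix i p
  assume "i < length (fin_trace fin \<sigma>' Xs n)" "p \<in> vars \<phi>"
  moreover from this have "p \<noteq> alive" "p \<noteq> fin" using assms by auto
  ultimately show "p \<in> inf_trace \<sigma> Xs i \<longleftrightarrow> p \<in> fin_trace fin \<sigma>' Xs n ! i"
    using inf_trace_agree[OF agree, where p = p and Xs = Xs and i = i] by (simp add: fin_trace_def)
qed (use assms in \<open>auto simp: fin_trace_def\<close>)

lemma constrained_winning_drop_alive:
  assumes spec: "constrained_spec X Y \<alpha> \<phi>"
    and fresh: "alive \<notin> X \<union> Y" "fin \<notin> X \<union> Y" "alive \<noteq> fin"
    and win: "ltl_winning X (Y \<union> {alive, fin}) (psi_constrained alive fin \<alpha> \<phi>) \<sigma>"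
  shows "constrained_winning fin X Y \<alpha> \<phi> (\<lambda>w. \<sigma> w - {alive})"
proof -
  let ?\<sigma> = "\<lambda>w. \<sigma> w - {alive}"
  have agree: "\<sigma> w - {alive} = ?\<sigma> w - {alive}" for w by simp
  have vars: "alive \<notin> vars \<alpha>" "alive \<notin> vars \<phi>" "fin \<notin> vars \<phi>"
    using spec fresh unfolding constrained_spec_def by auto
  have "?\<sigma> \<in> strategies X (Y \<union> {fin})"
    using win unfolding ltl_winning_def strategies_def by fastforce
  moreover have "(\<exists>\<^sub>\<le>\<^sub>1 n. ends_at fin ?\<sigma> Xs n) \<and>
      ((\<forall>n. \<not> ends_at fin ?\<sigma> Xs n) \<and> \<not> inf_trace ?\<sigma> Xs \<Turnstile>\<^sub>\<infinity> \<alpha> \<or>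
       (\<exists>n. ends_at fin ?\<sigma> Xs n \<and> fin_trace fin ?\<sigma> Xs n \<Turnstile>\<^sub>f \<phi>))"
    if Xs: "Xs \<in> inputs X" for Xs
  proof -
    define \<pi> where "\<pi> = inf_trace \<sigma> Xs"
    have ends: "ends_at fin ?\<sigma> Xs (Suc i) \<longleftrightarrow> fin \<in> \<pi> i" for i
      unfolding \<pi>_def ends_at_agree[OF agree fresh(3)[symmetric], symmetric]
      using ends_at_Suc_iff[OF Xs] fresh by blast
    have "\<pi> \<Turnstile>\<^sub>\<infinity> psi_constrained alive fin \<alpha> \<phi>"
      using win Xs by (simp add: ltl_winning_def \<pi>_def)
    then have fin: "\<And>i. fin \<in> \<pi> i \<longleftrightarrow> alive \<in> \<pi> i \<and> alive \<notin> \<pi> (Suc i)"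
      and once: "\<And>i j. fin \<in> \<pi> i \<Longrightarrow> i < j \<Longrightarrow> fin \<notin> \<pi> j"
      and inf: "\<pi> \<Turnstile>\<^sub>\<infinity> \<alpha> \<or> (\<exists>i. fin \<in> \<pi> i) \<Longrightarrow> \<pi> \<Turnstile>\<^sub>\<infinity> phi_inf alive \<phi>"
      unfolding ltl_models_psi_constrained ltl_models_psi_end by blast+
    \<comment> \<open>Of two distinct ending steps, the earlier would forbid the later by the second
      conjunct of \<open>psi_end\<close>.\<close>
    have "n = m" if nm: "ends_at fin ?\<sigma> Xs n" "ends_at fin ?\<sigma> Xs m" for n m
    proof -
      obtain n' m' where "n = Suc n'" "m = Suc m'"
        using nm by (metis ends_atE)
      with nm show ?thesis
        using once[of n' m'] once[of m' n']
        by (cases n' m' rule: linorder_cases) (auto simp: ends)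
    qed
    then have "\<exists>\<^sub>\<le>\<^sub>1 n. ends_at fin ?\<sigma> Xs n" by (simp add: Uniq_def)
    moreover have "(\<exists>n. ends_at fin ?\<sigma> Xs n \<and> fin_trace fin ?\<sigma> Xs n \<Turnstile>\<^sub>f \<phi>)"
      if prem: "\<pi> \<Turnstile>\<^sub>\<infinity> \<alpha> \<or> (\<exists>i. fin \<in> \<pi> i)"
    proof -
      obtain n where \<phi>: "\<pi> \<Turnstile>\<^sub>\<infinity> ltlf_to_ltl alive \<phi>" and n: "n \<ge> 1" "\<And>i. alive \<in> \<pi> i \<longleftrightarrow> i < n"
        using inf[OF prem] unfolding ltl_models_phi_inf by blast
      \<comment> \<open>The last alive position is \<open>n - 1\<close>; there
        \<open>psi_end\<close> forces \<open>fin\<close>, and this position is step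
        \<open>n\<close>.\<close>
      then have "ends_at fin ?\<sigma> Xs n"
        using ends[of "n - 1"] fin[of "n - 1"] by simp
      moreover have "fin_trace fin ?\<sigma> Xs n \<Turnstile>\<^sub>f \<phi>"
        using ltlf_to_ltl_models_agree[OF agree vars(2,3), where Xs = Xs and n = n] \<phi> n unfolding \<pi>_def by simp
      ultimately show ?thesis by blast
    qed
    moreover have "\<pi> \<Turnstile>\<^sub>\<infinity> \<alpha> \<longleftrightarrow> inf_trace ?\<sigma> Xs \<Turnstile>\<^sub>\<infinity> \<alpha>"
      unfolding \<pi>_def by (rule ltl_models_agree[OF agree vars(1)])
    moreover have "(\<forall>n. \<not> ends_at fin ?\<sigma> Xs n) \<longleftrightarrow> \<not> (\<exists>i. fin \<in> \<pi> i)"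
      using ends by (blast elim: ends_atE)
    ultimately show ?thesis by blast
  qed
  ultimately show ?thesis
    unfolding constrained_winning_iff by blast
qed

text \<open>Only proper nonempty prefixes are inspected, so \<open>alive\<close> is still played at
  the ending step itself. Removing \<open>alive\<close> from \<open>\<sigma> w\<close> first makes
  its presence depend on the second part alone, for every word \<open>w\<close>.\<close>

definition add_alive :: "'v \<Rightarrow> 'v \<Rightarrow> 'v strategy \<Rightarrow> 'v strategy" where
  "add_alive alive fin \<sigma> w =
     \<sigma> w - {alive} \<union> (if \<forall>k\<in>{1..<length w}. fin \<notin> \<sigma> (take k w) then {alive} else {})"

text \<open>Position \<open>i\<close> is produced from a word of length \<open>Suc i\<close>, whose
  proper prefixes have length at most \<open>i\<close>; \<open>k = 0\<close> is harmless, as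
  \<open>ends_at\<close> excludes it.\<close>

lemma alive_in_inf_trace_add_alive:
  assumes "Xs \<in> inputs X" "alive \<notin> X"
  shows "alive \<in> inf_trace (add_alive alive fin \<sigma>) Xs i \<longleftrightarrow> (\<forall>k\<le>i. \<not> ends_at fin \<sigma> Xs k)"
proof -
  have "take k (prefix (Suc i) Xs) = prefix k Xs" if "k \<le> i" for k
    using that by (simp add: take_map min_def)
  moreover have "alive \<notin> Xs i"
    using assms by (auto simp: inputs_def)
  ultimately show ?thesis
    by (auto simp: inf_trace_def add_alive_def ends_at_def less_Suc_eq_le simp del: upt_Suc)
qed

lemma ltl_winning_add_alive:
  assumes spec: "constrained_spec X Y \<alpha> \<phi>"
    and fresh: "alive \<notin> X \<union> Y" "fin \<notin> X \<union> Y" "alive \<noteq> fin"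
    and win: "constrained_winning fin X Y \<alpha> \<phi> \<sigma>"
  shows "ltl_winning X (Y \<union> {alive, fin}) (psi_constrained alive fin \<alpha> \<phi>) (add_alive alive fin \<sigma>)"
proof -
  let ?\<sigma> = "add_alive alive fin \<sigma>"
  have agree: "?\<sigma> w - {alive} = \<sigma> w - {alive}" for w by (auto simp: add_alive_def)
  have vars: "alive \<notin> vars \<alpha>" "alive \<notin> vars \<phi>" "fin \<notin> vars \<phi>"
    using spec fresh unfolding constrained_spec_def by auto
  have "\<sigma> \<in> strategies X (Y \<union> {fin})"
    using win unfolding constrained_winning_iff by blast
  then have "?\<sigma> \<in> strategies X (Y \<union> {alive, fin})"
    unfolding strategies_def add_alive_def by (fastforce simp: Pi_iff split: if_splits)
  moreover have "inf_trace ?\<sigma> Xs \<Turnstile>\<^sub>\<infinity> psi_constrained alive fin \<alpha> \<phi>" if Xs: "Xs \<in> inputs X" for Xs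
  proof -
    define \<pi> where "\<pi> = inf_trace ?\<sigma> Xs"
    have fin: "fin \<in> \<pi> i \<longleftrightarrow> ends_at fin \<sigma> Xs (Suc i)" for i
      unfolding \<pi>_def ends_at_agree[OF agree fresh(3)[symmetric], symmetric]
      using ends_at_Suc_iff[OF Xs] fresh by blast
    have alive: "alive \<in> \<pi> i \<longleftrightarrow> (\<forall>k\<le>i. \<not> ends_at fin \<sigma> Xs k)" for i
      unfolding \<pi>_def using alive_in_inf_trace_add_alive[OF Xs] fresh by blast
    have \<alpha>: "\<pi> \<Turnstile>\<^sub>\<infinity> \<alpha> \<longleftrightarrow> inf_trace \<sigma> Xs \<Turnstile>\<^sub>\<infinity> \<alpha>"
      unfolding \<pi>_def by (rule ltl_models_agree[OF agree vars(1)])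
    have uniq: "n = m" if "ends_at fin \<sigma> Xs n" "ends_at fin \<sigma> Xs m" for n m
      using win Xs that unfolding constrained_winning_iff Uniq_def by blast
    \<comment> \<open>If \<open>alive\<close> is lost between \<open>i\<close> and
      \<open>Suc i\<close>, the ending step can only be \<open>Suc i\<close>; conversely, uniqueness
      excludes an ending step before \<open>Suc i\<close>.\<close>
    have "\<pi> \<Turnstile>\<^sub>\<infinity> psi_end alive fin"
      unfolding ltl_models_psi_end alive fin
      by (metis Suc_inject Suc_n_not_le_n le_Suc_eq nat_less_le uniq)
    moreover have "\<pi> \<Turnstile>\<^sub>\<infinity> phi_inf alive \<phi>" if prem: "\<pi> \<Turnstile>\<^sub>\<infinity> \<alpha> \<or> (\<exists>i. fin \<in> \<pi> i)"
    proof -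
      \<comment> \<open>Either disjunct of \<open>prem\<close> contradicts the non-ending
        alternative of the winning condition, which leaves an ending step.\<close>
      obtain n where n: "ends_at fin \<sigma> Xs n" "fin_trace fin \<sigma> Xs n \<Turnstile>\<^sub>f \<phi>"
        using win Xs prem unfolding constrained_winning_iff \<alpha> fin by blast
      then have "n \<ge> 1" by (simp add: ends_at_def)
      moreover have "alive \<in> \<pi> i \<longleftrightarrow> i < n" for i
        unfolding alive using n(1) uniq by (metis not_le)
      moreover from calculation have "\<pi> \<Turnstile>\<^sub>\<infinity> ltlf_to_ltl alive \<phi>"
        using ltlf_to_ltl_models_agree[OF agree vars(2,3), where Xs = Xs and n = n] n(2)
        unfolding \<pi>_def by simp
      ultimately show ?thesis
        unfolding ltl_models_phi_inf by (intro conjI exI[of _ n]) simp_all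
    qed
    ultimately show ?thesis
      unfolding ltl_models_psi_constrained \<pi>_def by blast
  qed
  ultimately show ?thesis
    unfolding ltl_winning_def by blast
qed

theorem theorem5:
  fixes X Y :: "'v set" and \<alpha> \<phi> :: "'v formula" and alive fin :: 'v
  assumes "constrained_spec X Y \<alpha> \<phi>"
    and "alive \<notin> X \<union> Y" and "fin \<notin> X \<union> Y" and "alive \<noteq> fin"
  shows "(constrained_realizable fin X Y \<alpha> \<phi> \<longleftrightarrow>
          ltl_realizable X (Y \<union> {alive, fin}) (psi_constrained alive fin \<alpha> \<phi>)) \<and>
         (\<forall>\<sigma>. ltl_winning X (Y \<union> {alive, fin}) (psi_constrained alive fin \<alpha> \<phi>) \<sigma> \<longrightarrow>
              constrained_winning fin X Y \<alpha> \<phi> (\<lambda>w. \<sigma> w - {alive}))"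
  using constrained_winning_drop_alive[OF assms] ltl_winning_add_alive[OF assms]
  unfolding constrained_realizable_def ltl_realizable_def by blast

end
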